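(* Let $E$ be a Banach space, let $0\le S<T$, let $A_t$, $t\in[S,T]$, be generators of strongly continuous semigroups on $E$ with domains $D(A_t)$, let $Q_{t_1,t_2}$, $t_1,t_2\ge 0$, be a two-parameter family of bounded operators $E\to E$, and let $U(s,t)$, $S\le s\le t\le T$, be an evolution family of operators on $E$ with the generators $A_t$. Assume: 1) there exists a Banach space $Y\subset\bigcap_{t\in[S,T]}D(A_t)$ which is dense in $E$, invariant under $U(s,t)$ for all $S\le s\le t\le T$, i.e. $U(s,t)Y\subset Y$, and such that for every $t\in(S,T]$ the backward Cauchy problem $\dot u(s)=-A_su(s)$ on $[S,t]$, $u(t)=x$, is well-posed (backward solvable) for all $x\in Y$; 2) the function $[S,t]\to E$, $s\mapsto\frac{\partial}{\partial s}U(s,t)x$, is continuous for all $x\in Y$ and $t\in[S,T]$; 3) for any subinterval $[s,t]\subset[S,T]$ there exists a constant $M(s,t)>0$ such that for all finite sequences $s=\tau_1<\tau_2<\cdots<\tau_k\le t$ one has $\|Q_{\tau_1,\tau_2}\cdots Q_{\tau_{k-1},\tau_k}\|\le M(s,t)$; 4) for any subinterval $[s,t]\subset(S,T]$ and any fixed $x\in Y$, $$\frac{Q_{\tau-\Delta\tau,\tau}-I}{\Delta\tau}\,U(\tau,t)x\to A_\tau U(\tau,t)x\quad\text{in }E\text{ as }\Delta\tau\to0,\ \Delta\tau>0,$$ uniformly in $\tau\in[s,t]$. Then for any subinterval $[s,t]\subset[S,T]$, for any sequence (indexed by $n$) of partitions $\{s=t_0<t_1<\cdots<t_n=t\}$ of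 $[s,t]$ (the points $t_j$ depending on $n$) such that $\max_j(t_{j+1}-t_j)\to0$ as $n\to\infty$, and for all $x\in E$, $$Q_{t_0,t_1}\cdots Q_{t_{n-1},t_n}x\to U(s,t)x\quad\text{in }E,\qquad n\to\infty.$$
   Context: An evolution family with generators $A_t$ is a family of bounded operators $U(s,t)$ on $E$, $S\le s\le t\le T$, with $U(t,t)=I$, $U(s,r)U(r,t)=U(s,t)$ for $s\le r\le t$, strongly continuous in $(s,t)$, which solves the backward non-autonomous Cauchy problem $\dot u(s)=-A_su(s)$, $s\in[S,t]$, $u(t)=x$: for $x\in Y$ the function $u(s)=U(s,t)x$ is its solution, so $\frac{\partial}{\partial s}U(s,t)x=-A_sU(s,t)x$ (one-sided derivatives at endpoints). Well-posedness for all $x\in Y$ means that for each $t\in(S,T]$ and $x\in Y$ this problem has a unique solution, given by $u(s)=U(s,t)x$. The Banach space $Y$ is a linear subspace of $E$ carrying its own complete norm; "dense in $E$" refers to the norm of $E$.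
   Formalization: For s=S the claim as printed fails (A=0, U=I, Q_{S,b}=2I, other Q=I); there the formal theorem additionally assumes that the limit in 4) is uniform in τ∈(S,t] for steps with S≤τ-Δτ. For s>S nothing is added. *)

theory Defs
  imports "HOL-Analysis.Analysis"
begin

definition C0_semigroup :: "(real \<Rightarrow> 'a::banach \<Rightarrow>\<^sub>L 'a) \<Rightarrow> bool" where
  "C0_semigroup G \<longleftrightarrow>
     G 0 = id_blinfun \<and>
     (\<forall>r\<ge>0. \<forall>t\<ge>0. G (r + t) = G r o\<^sub>L G t) \<and>
     (\<forall>x. continuous_on {0..} (\<lambda>t. G t x))"

text \<open>
  An unbounded operator is a domain \<open>D\<close> together with a function \<open>A\<close>
  whose values outside \<open>D\<close> are irrelevant.
\<close>

definition generates :: "'a::banach set \<Rightarrow> ('a \<Rightarrow> 'a) \<Rightarrow> (real \<Rightarrow> 'a \<Rightarrow>\<^sub>L 'a) \<Rightarrow> bool" where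
  "generates D A G \<longleftrightarrow>
     D = {x. \<exists>y. ((\<lambda>h. (G h x - x) /\<^sub>R h) \<longlongrightarrow> y) (at_right 0)} \<and>
     (\<forall>x\<in>D. ((\<lambda>h. (G h x - x) /\<^sub>R h) \<longlongrightarrow> A x) (at_right 0))"

definition C0_generator :: "'a::banach set \<Rightarrow> ('a \<Rightarrow> 'a) \<Rightarrow> bool" where
  "C0_generator D A \<longleftrightarrow> (\<exists>G. C0_semigroup G \<and> generates D A G)"

text \<open>
  A linear subspace \<open>Y\<close> with its own complete norm \<open>N\<close>; no relation between \<open>N\<close>
  and the ambient norm is imposed, and \<open>N\<close> is unconstrained outside \<open>Y\<close>.
\<close>

definition banach_subspace :: "'a::real_vector set \<Rightarrow> ('a \<Rightarrow> real) \<Rightarrow> bool" where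
  "banach_subspace Y N \<longleftrightarrow>
     subspace Y \<and>
     (\<forall>x\<in>Y. 0 \<le> N x \<and> (N x = 0 \<longleftrightarrow> x = 0)) \<and>
     (\<forall>x\<in>Y. \<forall>c. N (c *\<^sub>R x) = \<bar>c\<bar> * N x) \<and>
     (\<forall>x\<in>Y. \<forall>y\<in>Y. N (x + y) \<le> N x + N y) \<and>
     (\<forall>f :: nat \<Rightarrow> 'a. range f \<subseteq> Y \<and>
        (\<forall>e>0. \<exists>K. \<forall>m\<ge>K. \<forall>n\<ge>K. N (f m - f n) < e) \<longrightarrow>
        (\<exists>l\<in>Y. (\<lambda>n. N (f n - l)) \<longlonglongrightarrow> 0))"

text \<open>
  Solutions of \<open>u'(s) = - A\<^sub>s u(s)\<close> on \<open>[S, t]\<close> with terminal value \<open>u(t) = x\<close>. The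
  derivative within \<open>{S..t}\<close> is one-sided at the endpoints.
\<close>

definition backward_solution ::
  "(real \<Rightarrow> 'a::banach set) \<Rightarrow> (real \<Rightarrow> 'a \<Rightarrow> 'a) \<Rightarrow> real \<Rightarrow> real \<Rightarrow> 'a \<Rightarrow> (real \<Rightarrow> 'a) \<Rightarrow> bool" where
  "backward_solution D A S t x u \<longleftrightarrow>
     u t = x \<and>
     (\<forall>s\<in>{S..t}. u s \<in> D s \<and> (u has_vector_derivative - A s (u s)) (at s within {S..t}))"

definition evolution_family ::
  "real \<Rightarrow> real \<Rightarrow> (real \<Rightarrow> real \<Rightarrow> 'a::banach \<Rightarrow>\<^sub>L 'a) \<Rightarrow> bool" where
  "evolution_family S T U \<longleftrightarrow>
     (\<forall>t\<in>{S..T}. U t t = id_blinfun) \<and>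
     (\<forall>s r t. S \<le> s \<and> s \<le> r \<and> r \<le> t \<and> t \<le> T \<longrightarrow> U s r o\<^sub>L U r t = U s t) \<and>
     (\<forall>x. continuous_on {(s, t). S \<le> s \<and> s \<le> t \<and> t \<le> T} (\<lambda>(s, t). U s t x))"

definition evolution_family_with_generators ::
  "(real \<Rightarrow> 'a::banach set) \<Rightarrow> (real \<Rightarrow> 'a \<Rightarrow> 'a) \<Rightarrow> 'a set \<Rightarrow> real \<Rightarrow> real \<Rightarrow>
     (real \<Rightarrow> real \<Rightarrow> 'a \<Rightarrow>\<^sub>L 'a) \<Rightarrow> bool" where
  "evolution_family_with_generators D A Y S T U \<longleftrightarrow>
     evolution_family S T U \<and>
     (\<forall>t\<in>{S..T}. \<forall>x\<in>Y. backward_solution D A S t x (\<lambda>s. U s t x))"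

definition backward_well_posed ::
  "(real \<Rightarrow> 'a::banach set) \<Rightarrow> (real \<Rightarrow> 'a \<Rightarrow> 'a) \<Rightarrow> real \<Rightarrow> real \<Rightarrow> 'a \<Rightarrow>
     (real \<Rightarrow> real \<Rightarrow> 'a \<Rightarrow>\<^sub>L 'a) \<Rightarrow> bool" where
  "backward_well_posed D A S t x U \<longleftrightarrow>
     backward_solution D A S t x (\<lambda>s. U s t x) \<and>
     (\<forall>u. backward_solution D A S t x u \<longrightarrow> (\<forall>s\<in>{S..t}. u s = U s t x))"

text \<open>
  \<open>ordered_prod Q \<tau> k\<close> is \<open>Q(\<tau> 0, \<tau> 1) Q(\<tau> 1, \<tau> 2) \<dots> Q(\<tau> (k - 1), \<tau> k)\<close>,
  with \<open>k\<close> factors and the earliest one applied last.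
\<close>

primrec ordered_prod ::
  "(real \<Rightarrow> real \<Rightarrow> 'a::banach \<Rightarrow>\<^sub>L 'a) \<Rightarrow> (nat \<Rightarrow> real) \<Rightarrow> nat \<Rightarrow> 'a \<Rightarrow>\<^sub>L 'a" where
  "ordered_prod Q \<tau> 0 = id_blinfun"
| "ordered_prod Q \<tau> (Suc k) = ordered_prod Q \<tau> k o\<^sub>L Q (\<tau> k) (\<tau> (Suc k))"

text \<open>
  Uniformity on \<open>(S, t]\<close> of
  \<open>(Q(\<tau> - h, \<tau>) - I) U(\<tau>, t) x / h \<rightarrow> A\<^sub>\<tau> U(\<tau>, t) x\<close>, for steps that stay
  in \<open>[S, t]\<close>. Uniformity on each \<open>[s, t]\<close> with \<open>s > S\<close> does not imply it and leaves
  the operators \<open>Q(S, r)\<close> unrelated to \<open>A\<close>: for \<open>A = 0\<close> and \<open>U = I\<close>, take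
  \<open>Q(S, r) = 2 I\<close> and \<open>Q(a, b) = I\<close> for \<open>a \<noteq> S\<close>; then every product starting at \<open>S\<close>
  equals \<open>2 I\<close>.
\<close>

definition uniformly_consistent_from_start ::
  "(real \<Rightarrow> real \<Rightarrow> 'a::banach \<Rightarrow>\<^sub>L 'a) \<Rightarrow> (real \<Rightarrow> 'a \<Rightarrow> 'a) \<Rightarrow>
     (real \<Rightarrow> real \<Rightarrow> 'a \<Rightarrow>\<^sub>L 'a) \<Rightarrow> 'a set \<Rightarrow> real \<Rightarrow> real \<Rightarrow> bool" where
  "uniformly_consistent_from_start Q A U Y S t \<longleftrightarrow>
     (\<forall>x\<in>Y. \<forall>e>0. \<exists>d>0. \<forall>\<tau>\<in>{S<..t}. \<forall>h. 0 < h \<and> h < d \<and> S \<le> \<tau> - h \<longrightarrow>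
        dist ((Q (\<tau> - h) \<tau> - id_blinfun) (U \<tau> t x) /\<^sub>R h) (A \<tau> (U \<tau> t x)) < e)"

end

theory Submission
  imports Defs
begin

text \<open>
  With \<open>u(r) = U(r, t) x\<close>, the error \<open>Q(t\<^sub>0, t\<^sub>1) \<dots> Q(t\<^sub>n\<^sub>-\<^sub>1, t\<^sub>n) x - U(s, t) x\<close> telescopes
  into the sum of the terms
  \<open>Q(t\<^sub>0, t\<^sub>1) \<dots> Q(t\<^sub>j\<^sub>-\<^sub>1, t\<^sub>j) (Q(t\<^sub>j, t\<^sub>j\<^sub>+\<^sub>1) u(t\<^sub>j\<^sub>+\<^sub>1) - u(t\<^sub>j))\<close>.
  The products on the left are uniformly bounded. For \<open>x\<close> in \<open>Y\<close>, both \<open>Q(\<tau> - h, \<tau>) u(\<tau>)\<close> and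
  \<open>u(\<tau> - h)\<close> equal \<open>u(\<tau>) + h A\<^sub>\<tau> u(\<tau>)\<close> up to \<open>o(h)\<close> uniformly in \<open>\<tau>\<close>, the first by
  consistency and the second because \<open>u\<close> is continuously differentiable. So the error tends to
  \<open>0\<close> with the mesh. Density of \<open>Y\<close> and uniform boundedness extend the convergence to all of \<open>E\<close>.
\<close>

text \<open>Appending the factor \<open>Q (p j) (p (Suc j))\<close> turns the j-th product into the
  next one, so the j-th summand is \<open>ordered_prod Q p (Suc j) (v (Suc j)) - ordered_prod Q p j
  (v j)\<close>.\<close>

lemma ordered_prod_telescope:
  "ordered_prod Q p k (v k) - v 0 =
     (\<Sum>j<k. ordered_prod Q p j (Q (p j) (p (Suc j)) (v (Suc j)) - v j))"
  by (induction k) (simp_all add: blinfun.diff_right algebra_simps)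

text \<open>Local errors proportional to the step length add up to a multiple of
  \<open>p k - p 0\<close>, whatever the number of steps. Only the proper prefixes of the product
  act on local errors.\<close>

lemma ordered_prod_error_le:
  assumes bound: "\<And>j. j < k \<Longrightarrow> norm (ordered_prod Q p j) \<le> C"
    and "0 \<le> C"
    and local_error: "\<And>j. j < k \<Longrightarrow>
      norm (Q (p j) (p (Suc j)) (u (p (Suc j))) - u (p j)) \<le> e * (p (Suc j) - p j)"
  shows "norm (ordered_prod Q p k (u (p k)) - u (p 0)) \<le> C * e * (p k - p 0)"
proof -
  have "norm (ordered_prod Q p k (u (p k)) - u (p 0)) \<le>
      (\<Sum>j<k. norm (ordered_prod Q p j (Q (p j) (p (Suc j)) (u (p (Suc j))) - u (p j))))"
    unfolding ordered_prod_telescope[of Q p k "\<lambda>j. u (p j)"] by (rule norm_sum)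
  also have "\<dots> \<le> (\<Sum>j<k. C * (e * (p (Suc j) - p j)))"
  proof (rule sum_mono)
    fix j assume "j \<in> {..<k}"
    then have "j < k" by simp
    have "norm (ordered_prod Q p j (Q (p j) (p (Suc j)) (u (p (Suc j))) - u (p j))) \<le>
        norm (ordered_prod Q p j) * norm (Q (p j) (p (Suc j)) (u (p (Suc j))) - u (p j))"
      by (rule norm_blinfun)
    also have "\<dots> \<le> C * (e * (p (Suc j) - p j))"
      using bound[OF \<open>j < k\<close>] local_error[OF \<open>j < k\<close>] \<open>0 \<le> C\<close> by (intro mult_mono) auto
    finally show "norm (ordered_prod Q p j (Q (p j) (p (Suc j)) (u (p (Suc j))) - u (p j))) \<le>
        C * (e * (p (Suc j) - p j))" .
  qed
  also have "\<dots> = C * e * (\<Sum>j<k. p (Suc j) - p j)"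
    by (simp add: sum_distrib_left mult.assoc)
  also have "\<dots> = C * e * (p k - p 0)"
    by (simp only: sum_lessThan_telescope)
  finally show ?thesis .
qed

text \<open>By compactness \<open>u'\<close> is uniformly continuous, so on a short interval
  \<open>{r..\<tau>}\<close> it stays within \<open>e\<close> of \<open>u' \<tau>\<close>, and the
  mean value inequality applies. The expansion is about the right endpoint because consistency is
  also stated there.\<close>

lemma uniform_linearization:
  fixes u :: "real \<Rightarrow> 'a::real_normed_vector"
  assumes deriv: "\<And>r. r \<in> {a..b} \<Longrightarrow> (u has_vector_derivative u' r) (at r within {a..b})"
    and cont: "continuous_on {a..b} u'"
    and "0 < e"
  obtains d where "0 < d"
    and "\<And>r \<tau>. a \<le> r \<Longrightarrow> r \<le> \<tau> \<Longrightarrow> \<tau> \<le> b \<Longrightarrow> \<tau> - r < d \<Longrightarrow>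
      norm (u r - u \<tau> + (\<tau> - r) *\<^sub>R u' \<tau>) \<le> e * (\<tau> - r)"
proof -
  have "uniformly_continuous_on {a..b} u'"
    using cont by (intro compact_uniformly_continuous) auto
  then obtain d where d: "0 < d"
    "\<And>r \<tau>. r \<in> {a..b} \<Longrightarrow> \<tau> \<in> {a..b} \<Longrightarrow> dist r \<tau> < d \<Longrightarrow> dist (u' r) (u' \<tau>) < e"
    using \<open>0 < e\<close> unfolding uniformly_continuous_on_def by metis
  show thesis
  proof (rule that[OF \<open>0 < d\<close>])
    fix r \<tau> assume r\<tau>: "a \<le> r" "r \<le> \<tau>" "\<tau> \<le> b" "\<tau> - r < d"
    have "norm (u r - u \<tau> - (r - \<tau>) *\<^sub>R u' \<tau>) \<le> norm (r - \<tau>) * e"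
    proof (rule vector_differentiable_bound_linearization[where S = "{r..\<tau>}"])
      fix q assume q: "q \<in> {r..\<tau>}"
      then show "(u has_vector_derivative u' q) (at q within {r..\<tau>})"
        using r\<tau> by (intro has_vector_derivative_within_subset[OF deriv]) auto
      have "dist (u' q) (u' \<tau>) < e"
        using q r\<tau> by (intro d(2)) (auto simp: dist_real_def)
      then show "norm (u' q - u' \<tau>) \<le> e"
        by (simp add: dist_norm)
    qed (use r\<tau> in \<open>auto simp: closed_segment_eq_real_ivl\<close>)
    then show "norm (u r - u \<tau> + (\<tau> - r) *\<^sub>R u' \<tau>) \<le> e * (\<tau> - r)"
      using r\<tau> by (simp add: algebra_simps)
  qed
qed

lemma blinfun_tendsto_of_dense:
  fixes L :: "'i \<Rightarrow> 'a::real_normed_vector \<Rightarrow>\<^sub>L 'b::real_normed_vector"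
    and L' :: "'a \<Rightarrow>\<^sub>L 'b"
  assumes bound: "\<And>n. norm (L n) \<le> C"
    and dense: "closure Y = UNIV"
    and conv: "\<And>y. y \<in> Y \<Longrightarrow> ((\<lambda>n. L n y) \<longlongrightarrow> L' y) F"
  shows "((\<lambda>n. L n x) \<longlongrightarrow> L' x) F"
proof (rule tendstoI)
  fix e :: real assume "0 < e"
  \<comment> \<open>\<open>B\<close> bounds \<open>norm (L n - L')\<close> for every
    \<open>n\<close>; the summand 1 keeps it positive, so that \<open>e / 2 / B\<close> is a
    legitimate radius.\<close>
  define B where "B = max C 0 + norm L' + 1"
  have "0 < B" unfolding B_def by (smt (verit) norm_ge_zero)
  have "x \<in> closure Y" using dense by simp
  then obtain y where y: "y \<in> Y" "dist y x < e / 2 / B"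
    using \<open>0 < e\<close> \<open>0 < B\<close> unfolding closure_approachable by (meson divide_pos_pos zero_less_numeral)
  have "\<forall>\<^sub>F n in F. dist (L n y) (L' y) < e / 2"
    using tendstoD[OF conv[OF y(1)], of "e / 2"] \<open>0 < e\<close> by simp
  then show "\<forall>\<^sub>F n in F. dist (L n x) (L' x) < e"
  proof eventually_elim
    case (elim n)
    have "L n x - L' x = (L n - L') (x - y) + (L n y - L' y)"
      by (simp add: blinfun.diff_left blinfun.diff_right)
    then have "norm (L n x - L' x) \<le> norm ((L n - L') (x - y)) + norm (L n y - L' y)"
      by (metis norm_triangle_ineq)
    also have "norm ((L n - L') (x - y)) \<le> norm (L n - L') * norm (x - y)"
      by (rule norm_blinfun)
    also have "\<dots> \<le> B * norm (x - y)"
    proof (rule mult_right_mono)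
      show "norm (L n - L') \<le> B"
        using norm_triangle_ineq4[of "L n" L'] bound[of n] unfolding B_def by linarith
    qed simp
    also have "\<dots> \<le> e / 2"
      using y(2) \<open>0 < B\<close> by (simp add: dist_norm norm_minus_commute field_simps)
    finally show ?case
      using elim by (simp add: dist_norm)
  qed
qed

text \<open>In \<open>consistent\<close> the threshold for \<open>h\<close> may shrink as
  \<open>s\<close> approaches \<open>S\<close>, so a step starting at \<open>S\<close> itself is not
  controlled; this is why the case \<open>s = S\<close> carries a premise of its own. The n-th
  partition has \<open>k n\<close> steps, and refinement is measured by the mesh alone.\<close>

theorem theorem1:
  fixes S T :: real
    and D :: "real \<Rightarrow> 'a::banach set"
    and A :: "real \<Rightarrow> 'a \<Rightarrow> 'a"
    and Q U :: "real \<Rightarrow> real \<Rightarrow> 'a \<Rightarrow>\<^sub>L 'a"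
    and Y :: "'a set"
    and N :: "'a \<Rightarrow> real"
  assumes "0 \<le> S" and "S < T"
    and gen: "\<And>t. t \<in> {S..T} \<Longrightarrow> C0_generator (D t) (A t)"
    and evol: "evolution_family_with_generators D A Y S T U"
    and Y_banach: "banach_subspace Y N"
    and Y_dom: "Y \<subseteq> (\<Inter>t\<in>{S..T}. D t)"
    and Y_dense: "closure Y = UNIV"
    and Y_inv: "\<And>s t. S \<le> s \<Longrightarrow> s \<le> t \<Longrightarrow> t \<le> T \<Longrightarrow> blinfun_apply (U s t) ` Y \<subseteq> Y"
    and well_posed: "\<And>t x. t \<in> {S<..T} \<Longrightarrow> x \<in> Y \<Longrightarrow> backward_well_posed D A S t x U"
    and deriv_cont: "\<And>t x. t \<in> {S..T} \<Longrightarrow> x \<in> Y \<Longrightarrow>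
      continuous_on {S..t} (\<lambda>s. vector_derivative (\<lambda>r. U r t x) (at s within {S..t}))"
    and stable: "\<And>s t. S \<le> s \<Longrightarrow> s < t \<Longrightarrow> t \<le> T \<Longrightarrow>
      \<exists>M>0. \<forall>(\<tau> :: nat \<Rightarrow> real) k. k \<ge> 1 \<and> \<tau> 0 = s \<and> (\<forall>j<k. \<tau> j < \<tau> (Suc j)) \<and> \<tau> k \<le> t \<longrightarrow>
        norm (ordered_prod Q \<tau> k) \<le> M"
    and consistent: "\<And>s t x. S < s \<Longrightarrow> s < t \<Longrightarrow> t \<le> T \<Longrightarrow> x \<in> Y \<Longrightarrow>
      uniform_limit {s..t}
        (\<lambda>h \<tau>. (Q (\<tau> - h) \<tau> - id_blinfun) (U \<tau> t x) /\<^sub>R h)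
        (\<lambda>\<tau>. A \<tau> (U \<tau> t x)) (at_right 0)"
  shows "\<forall>s t. S \<le> s \<and> s < t \<and> t \<le> T \<and>
      (s = S \<longrightarrow> uniformly_consistent_from_start Q A U Y S t) \<longrightarrow>
    (\<forall>(p :: nat \<Rightarrow> nat \<Rightarrow> real) (k :: nat \<Rightarrow> nat).
      (\<forall>n. p n 0 = s \<and> p n (k n) = t \<and> (\<forall>j<k n. p n j < p n (Suc j))) \<and>
      (\<lambda>n. MAX j\<in>{..<k n}. p n (Suc j) - p n j) \<longlonglongrightarrow> 0 \<longrightarrow>
      (\<forall>x. (\<lambda>n. ordered_prod Q (p n) (k n) x) \<longlonglongrightarrow> U s t x))"
proof (intro allI impI)
  fix s t and p :: "nat \<Rightarrow> nat \<Rightarrow> real" and k :: "nat \<Rightarrow> nat" and x :: 'a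
  assume st: "S \<le> s \<and> s < t \<and> t \<le> T \<and>
    (s = S \<longrightarrow> uniformly_consistent_from_start Q A U Y S t)"
  assume part: "(\<forall>n. p n 0 = s \<and> p n (k n) = t \<and> (\<forall>j<k n. p n j < p n (Suc j))) \<and>
    (\<lambda>n. MAX j\<in>{..<k n}. p n (Suc j) - p n j) \<longlonglongrightarrow> 0"
  have ends: "p n 0 = s" "p n (k n) = t" and step: "j < k n \<Longrightarrow> p n j < p n (Suc j)" for n j
    using part by auto
  have mono: "p n i \<le> p n j" if "i \<le> j" "j \<le> k n" for n i j
    using that
  proof (induction j rule: dec_induct)
    case (step j)
    then show ?case using part by (smt (verit) Suc_le_eq less_imp_le_nat)
  qed simp
  obtain M where M: "0 < M"
    "\<And>\<tau> m. m \<ge> 1 \<Longrightarrow> \<tau> 0 = s \<Longrightarrow> \<forall>j<m. \<tau> j < \<tau> (Suc j) \<Longrightarrow> \<tau> m \<le> t \<Longrightarrow>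
      norm (ordered_prod Q \<tau> m) \<le> M"
    using stable[of s t] st by metis
  \<comment> \<open>\<open>stable\<close> speaks of products with at least one factor; the 1 covers
    the empty product, which is the identity.\<close>
  define C where "C = max 1 M"
  \<comment> \<open>A prefix of a partition is again an increasing sequence from \<open>s\<close>
    ending at or before \<open>t\<close>, so the same \<open>M\<close> serves all \<open>n\<close>
    and \<open>j\<close>.\<close>
  have bound: "norm (ordered_prod Q (p n) j) \<le> C" if "j \<le> k n" for n j
  proof (cases "j = 0")
    case True
    then show ?thesis using norm_blinfun_id_le[where 'a = 'a] by (simp add: C_def)
  next
    case False
    then have "norm (ordered_prod Q (p n) j) \<le> M"
      using that ends[of n] step[of _ n] mono[of j "k n" n] by (intro M(2)) auto
    then show ?thesis by (simp add: C_def)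
  qed

  show "(\<lambda>n. ordered_prod Q (p n) (k n) x) \<longlonglongrightarrow> U s t x"
  proof (rule blinfun_tendsto_of_dense[OF bound[OF order_refl] Y_dense])
    fix y assume "y \<in> Y"
    define u where "u r = blinfun_apply (U r t) y" for r
    have sol: "backward_solution D A S t y u"
      using evol st \<open>y \<in> Y\<close> unfolding evolution_family_with_generators_def u_def by auto
    then have ut: "u t = y"
      by (simp add: backward_solution_def)
    have deriv: "(u has_vector_derivative - A r (u r)) (at r within {S..t})" if "r \<in> {S..t}" for r
      using sol that by (simp add: backward_solution_def)
    have "continuous_on {S..t} (\<lambda>r. vector_derivative u (at r within {S..t}))"
      using deriv_cont[of t y] st \<open>y \<in> Y\<close> by (simp add: u_def[abs_def])
    \<comment> \<open>Since \<open>S < t\<close>, derivatives within \<open>{S..t}\<close> are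
      unique, which carries the continuity in \<open>deriv_cont\<close> over to
      \<open>- A r (u r)\<close>.\<close>
    moreover have "vector_derivative u (at r within {S..t}) = - A r (u r)" if "r \<in> {S..t}" for r
      using vector_derivative_within_cbox[of S t r u "- A r (u r)"] deriv[OF that] that st by simp
    ultimately have cont: "continuous_on {S..t} (\<lambda>r. - A r (u r))"
      by (rule continuous_on_eq)

    \<comment> \<open>A common form for \<open>s = S\<close> and \<open>s > S\<close>, restricted to
      steps that stay in \<open>{s..t}\<close>, as those of a partition do.\<close>
    have consist: "\<exists>d>0. \<forall>\<tau>\<in>{s<..t}. \<forall>h. 0 < h \<and> h < d \<and> s \<le> \<tau> - h \<longrightarrow>
        dist ((Q (\<tau> - h) \<tau> - id_blinfun) (u \<tau>) /\<^sub>R h) (A \<tau> (u \<tau>)) < e"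
      if "0 < e" for e
    proof (cases "s = S")
      case True
      then show ?thesis
        using st \<open>y \<in> Y\<close> that unfolding uniformly_consistent_from_start_def u_def by blast
    next
      case False
      then have "uniform_limit {s..t} (\<lambda>h \<tau>. (Q (\<tau> - h) \<tau> - id_blinfun) (u \<tau>) /\<^sub>R h)
          (\<lambda>\<tau>. A \<tau> (u \<tau>)) (at_right 0)"
        using consistent[of s t y] st \<open>y \<in> Y\<close> unfolding u_def by auto
      from uniform_limitD[OF this that] show ?thesis
        unfolding eventually_at_right_field by force
    qed

    have "(\<lambda>n. ordered_prod Q (p n) (k n) y) \<longlonglongrightarrow> u s"
    proof (rule tendstoI)
      fix e :: real assume "0 < e"
      \<comment> \<open>Local errors will be at most \<open>2 * e'\<close> per unit length, so the
        total is at most \<open>C * (2 * e') * (t - s) = e / 2\<close>.\<close>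
      define e' where "e' = e / (4 * C * (t - s))"
      have "0 < C" by (simp add: C_def)
      have "0 < e'" using \<open>0 < e\<close> \<open>0 < C\<close> st by (simp add: e'_def)
      obtain d1 where "0 < d1" and d1: "\<And>\<tau> h. s < \<tau> \<Longrightarrow> \<tau> \<le> t \<Longrightarrow> 0 < h \<Longrightarrow> h < d1 \<Longrightarrow> s \<le> \<tau> - h \<Longrightarrow>
          dist ((Q (\<tau> - h) \<tau> - id_blinfun) (u \<tau>) /\<^sub>R h) (A \<tau> (u \<tau>)) < e'"
        using consist[OF \<open>0 < e'\<close>] by (metis greaterThanAtMost_iff)
      obtain d2 where "0 < d2" and d2: "\<And>r \<tau>. S \<le> r \<Longrightarrow> r \<le> \<tau> \<Longrightarrow> \<tau> \<le> t \<Longrightarrow> \<tau> - r < d2 \<Longrightarrow>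
          norm (u r - u \<tau> + (\<tau> - r) *\<^sub>R (- A \<tau> (u \<tau>))) \<le> e' * (\<tau> - r)"
        using uniform_linearization[OF deriv cont \<open>0 < e'\<close>] by blast
      \<comment> \<open>Consistency and linearization each contribute \<open>h * e'\<close>. The
        linearization uses \<open>- A \<tau> (u \<tau>)\<close> as derivative, so both expansions
        have the same first-order term and it cancels.\<close>
      have local_error: "norm (Q r \<tau> (u \<tau>) - u r) \<le> 2 * e' * (\<tau> - r)"
        if "s \<le> r" "r < \<tau>" "\<tau> \<le> t" "\<tau> - r < min d1 d2" for r \<tau>
      proof -
        define h where "h = \<tau> - r"
        have "0 < h" using that by (simp add: h_def)
        have "norm ((Q r \<tau> - id_blinfun) (u \<tau>) /\<^sub>R h - A \<tau> (u \<tau>)) < e'"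
          using d1[of \<tau> h] that by (simp add: h_def dist_norm)
        then have "h * norm ((Q r \<tau> - id_blinfun) (u \<tau>) /\<^sub>R h - A \<tau> (u \<tau>)) \<le> h * e'"
          using \<open>0 < h\<close> by simp
        moreover have "h * norm ((Q r \<tau> - id_blinfun) (u \<tau>) /\<^sub>R h - A \<tau> (u \<tau>)) =
            norm (h *\<^sub>R ((Q r \<tau> - id_blinfun) (u \<tau>) /\<^sub>R h - A \<tau> (u \<tau>)))"
          using \<open>0 < h\<close> by simp
        moreover have "h *\<^sub>R ((Q r \<tau> - id_blinfun) (u \<tau>) /\<^sub>R h - A \<tau> (u \<tau>)) =
            Q r \<tau> (u \<tau>) - u \<tau> - h *\<^sub>R A \<tau> (u \<tau>)"
          using \<open>0 < h\<close> by (simp add: blinfun.diff_left scaleR_diff_right)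
        ultimately have "norm (Q r \<tau> (u \<tau>) - u \<tau> - h *\<^sub>R A \<tau> (u \<tau>)) \<le> h * e'"
          by simp
        moreover have "norm (u r - u \<tau> - h *\<^sub>R A \<tau> (u \<tau>)) \<le> h * e'"
          using d2[of r \<tau>] that st by (simp add: h_def mult.commute)
        moreover have "Q r \<tau> (u \<tau>) - u r =
            (Q r \<tau> (u \<tau>) - u \<tau> - h *\<^sub>R A \<tau> (u \<tau>)) - (u r - u \<tau> - h *\<^sub>R A \<tau> (u \<tau>))"
          by simp
        ultimately have "norm (Q r \<tau> (u \<tau>) - u r) \<le> h * e' + h * e'"
          by (smt (verit) norm_triangle_ineq4)
        then show ?thesis by (simp add: h_def algebra_simps)
      qed
      \<comment> \<open>Once the mesh is below both thresholds, \<open>local_error\<close> applies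
        to every step of the partition.\<close>
      have "\<forall>\<^sub>F n in sequentially. dist (MAX j\<in>{..<k n}. p n (Suc j) - p n j) 0 < min d1 d2"
        using part \<open>0 < d1\<close> \<open>0 < d2\<close> by (intro tendstoD) auto
      then show "\<forall>\<^sub>F n in sequentially. dist (ordered_prod Q (p n) (k n) y) (u s) < e"
      proof eventually_elim
        case (elim n)
        have small: "p n (Suc j) - p n j < min d1 d2" if "j < k n" for j
        proof -
          have "p n (Suc j) - p n j \<le> (MAX j\<in>{..<k n}. p n (Suc j) - p n j)"
            using that by (intro Max_ge) auto
          then show ?thesis using elim unfolding dist_real_def by linarith
        qed
        have "norm (ordered_prod Q (p n) (k n) (u (p n (k n))) - u (p n 0)) \<le>
            C * (2 * e') * (p n (k n) - p n 0)"
        proof (rule ordered_prod_error_le)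
          fix j assume j: "j < k n"
          show "norm (ordered_prod Q (p n) j) \<le> C"
            using bound j by simp
          show "norm (Q (p n j) (p n (Suc j)) (u (p n (Suc j))) - u (p n j)) \<le>
              2 * e' * (p n (Suc j) - p n j)"
            using j mono[of 0 j n] mono[of "Suc j" "k n" n] step[OF j] small[OF j] ends[of n]
            by (intro local_error) auto
        qed (use \<open>0 < C\<close> in simp)
        also have "\<dots> = e / 2"
          using \<open>0 < C\<close> st by (simp add: ends e'_def field_simps)
        finally show ?case
          using \<open>0 < e\<close> by (simp add: ends ut dist_norm)
      qed
    qed
    then show "(\<lambda>n. ordered_prod Q (p n) (k n) y) \<longlonglongrightarrow> U s t y"
      by (simp add: u_def)
  qed
qed

end
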